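(* Let $X$ be a regular topological space. If $X$ is Lindelöf, scattered, and a $W$-space, then $X$ is $\sigma$-compact (i.e. $X$ is a union of countably many compact subsets).
   Context: Regular spaces are understood to be $T_1$ (hence Hausdorff). A space $X$ is scattered if every nonempty subspace of $X$ has an isolated point (in the subspace topology); equivalently, some Cantor–Bendixson derivative $X^{(\alpha)}$ is empty. $W$-game: given a space $X$ and a point $x\in X$, the $W$-game at $x$ is played by players I and II in $\omega$ many rounds. In the $n$-th round ($n=1,2,\ldots$), player I picks an open neighborhood $U_n$ of $x$ in $X$, and player II responds by choosing a point $x_n\in U_n$. Player I wins if the sequence $(x_n)_{n=1}^\infty$ converges to $x$; otherwise player II wins. A strategy for player I is a function $\sigma$ assigning to each finite sequence of points of $X$ (the previous moves of player II, including the empty sequence) an open neighborhood of $x$; it is winning if every infinite sequence $(x_1,x_2,\ldots)$ in $X$ with $x_1\in\sigma(\emptyset)$ and $x_{i+1}\in\sigma(x_1,\ldots,x_i)$ for all $i\ge 1$ converges to $x$. The point $x$ is a $W$-point of $X$ if player I has a winning strategy in the $W$-game at $x$. The space $X$ is a $W$-space if every point of $X$ is a $W$-point. *)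

theory Defs
  imports "HOL-Analysis.Analysis"
begin

definition scattered_space :: "'a topology \<Rightarrow> bool" where
  "scattered_space X \<longleftrightarrow>
     (\<forall>A. A \<subseteq> topspace X \<and> A \<noteq> {} \<longrightarrow> (\<exists>a\<in>A. openin (subtopology X A) {a}))"

definition sigma_compact_space :: "'a topology \<Rightarrow> bool" where
  "sigma_compact_space X \<longleftrightarrow>
     (\<exists>\<K>. countable \<K> \<and> (\<forall>K\<in>\<K>. compactin X K) \<and> \<Union>\<K> = topspace X)"

(* A strategy for player I maps the list of the previous moves of player II (oldest first)
   to an open neighbourhood of x; its values on lists with entries outside the space are
   irrelevant. *)
definition W_strategy :: "'a topology \<Rightarrow> 'a \<Rightarrow> ('a list \<Rightarrow> 'a set) \<Rightarrow> bool" where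
  "W_strategy X x \<sigma> \<longleftrightarrow>
     (\<forall>ps. set ps \<subseteq> topspace X \<longrightarrow> openin X (\<sigma> ps) \<and> x \<in> \<sigma> ps)"

(* The moves of player II are indexed from 0, so s n is the answer in round n + 1, made
   after the n moves s 0, ..., s (n - 1). *)
definition W_winning_strategy :: "'a topology \<Rightarrow> 'a \<Rightarrow> ('a list \<Rightarrow> 'a set) \<Rightarrow> bool" where
  "W_winning_strategy X x \<sigma> \<longleftrightarrow> W_strategy X x \<sigma> \<and>
     (\<forall>s :: nat \<Rightarrow> 'a. range s \<subseteq> topspace X \<and> (\<forall>n. s n \<in> \<sigma> (map s [0..<n]))
        \<longrightarrow> limitin X s x sequentially)"

definition W_point :: "'a topology \<Rightarrow> 'a \<Rightarrow> bool" where
  "W_point X x \<longleftrightarrow> x \<in> topspace X \<and> (\<exists>\<sigma>. W_winning_strategy X x \<sigma>)"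

definition W_space :: "'a topology \<Rightarrow> bool" where
  "W_space X \<longleftrightarrow> (\<forall>x\<in>topspace X. W_point X x)"

end

(*
  Call M closed if it is closed under a countable-valued operation on finite sequences that records
  countable subcovers and nested moves of the winning strategies. Well-foundedness of the scattered
  space yields for every point p a point y of M such that p lies in all neighbourhoods of y that the
  strategy at y prescribes after moves in M, and this y is unique. The map p |-> y is a retraction
  onto M. By induction on the cardinality, closed sets are sigma-compact: an uncountable M is the
  union of an increasing chain of smaller closed sets, every point reaches the bottom of the chain
  by finitely many retractions, and the strategies show that the points whose retractions stay in
  given compact pieces form a compact set.
*)

theory Submission
  imports Defs
begin

unbundle cardinal_syntax

section \<open>Scattered spaces\<close>

text \<open>Cantor-Bendixson ranks without ordinals: the isolated points of what remains are removed
  along a well-ordering, and \<open>R\<close> relates \<open>z\<close> to \<open>y\<close> if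
  \<open>z\<close> is gone at a stage that \<open>y\<close> survives. At its own removal
  \<open>y\<close> is isolated among the remaining points, so some neighbourhood contains besides
  \<open>y\<close> only points of smaller rank.\<close>

lemma scattered_space_wf:
  assumes "scattered_space X"
  obtains R :: "'a rel" where "wf R"
    "\<And>y. y \<in> topspace X \<Longrightarrow> \<exists>U. openin X U \<and> y \<in> U \<and> (\<forall>z\<in>U. z \<noteq> y \<longrightarrow> (z, y) \<in> R)"
proof -
  \<comment> \<open>The index type \<open>'a set\<close> has more elements than \<open>'a\<close>,
    so the removal must exhaust the space before the indices run out.\<close>
  obtain r :: "'a set rel" where r: "Well_order r" "Field r = UNIV"
    using well_ordering[where 'a = "'a set"] by metis
  then have lin: "Linear_order r"
    by (simp add: well_order_on_def)
  define Q where "Q = r - Id"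
  have wfQ: "wf Q"
    using r by (simp add: Q_def well_order_on_def)
  have total: "i = j \<or> (i, j) \<in> Q \<or> (j, i) \<in> Q" for i j
  proof -
    have "Total r"
      using lin by (simp add: linear_order_on_def)
    then show ?thesis
      using r(2) unfolding Q_def total_on_def by blast
  qed
  define iso where "iso S = {a \<in> topspace X. openin (subtopology X (topspace X - S)) {a}}" for S
  define step where "step g i = (let S = \<Union>j\<in>{j. (j, i) \<in> Q}. g j in S \<union> iso S)" for g i
  define G where "G = wfrec Q step"
  have "adm_wf Q step"
    unfolding adm_wf_def step_def by (auto simp: Let_def)
  then have G: "G = step G"
    unfolding G_def using wfQ by (rule wfrec_fixpoint[rotated])
  \<comment> \<open>\<open>S i\<close> is what is removed before stage \<open>i\<close>,
    \<open>G i\<close> what is removed up to and including it.\<close>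
  define S where "S i = (\<Union>j\<in>{j. (j, i) \<in> Q}. G j)" for i
  have GS: "G i = S i \<union> iso (S i)" for i
    by (subst G) (simp add: step_def S_def Let_def)
  have iso_disj: "iso S \<inter> S = {}" for S
    unfolding iso_def by (auto dest!: openin_subset)
  have S_mono: "(i, j) \<in> Q \<Longrightarrow> G i \<subseteq> S j" for i j
    by (auto simp: S_def)
  have "\<exists>i. topspace X \<subseteq> S i"
  proof (rule ccontr)
    assume "\<not> ?thesis"
    then have nonempty: "topspace X - S i \<noteq> {}" for i
      by blast
    have "iso (S i) \<noteq> {}" for i
    proof -
      obtain a where "a \<in> topspace X - S i" "openin (subtopology X (topspace X - S i)) {a}"
        using assms nonempty[of i] unfolding scattered_space_def by (meson Diff_subset)
      then show ?thesis
        by (auto simp: iso_def)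
    qed
    then have "\<exists>a. a \<in> iso (S i)" for i
      by blast
    then obtain a where a: "\<And>i. a i \<in> iso (S i)"
      by metis
    have neq: "(i, j) \<in> Q \<Longrightarrow> a i \<noteq> a j" for i j
      using S_mono[of i j] GS[of i] a[of i] a[of j] iso_disj[of "S j"] by auto
    \<comment> \<open>Different stages remove different points, so a process that never ends embeds
      the power set of the type into the type, against Cantor.\<close>
    have "inj a"
      by (rule injI) (metis neq total)
    then have "inv a ` UNIV = Pow UNIV"
      by (simp add: inj_imp_surj_inv)
    then show False
      using Cantors_theorem by metis
  qed
  then obtain i0 where i0: "topspace X \<subseteq> S i0"
    by blast
  define R where "R = {(z, y). \<exists>i. z \<in> G i \<and> y \<notin> G i \<and> y \<in> topspace X}"
  have "wf R"
  proof (rule wfI_min)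
    fix x and B :: "'a set"
    assume x: "x \<in> B"
    show "\<exists>z\<in>B. \<forall>y. (y, z) \<in> R \<longrightarrow> y \<notin> B"
    \<comment> \<open>A point outside the space has no \<open>R\<close>-predecessor. Otherwise any
      point of \<open>B\<close> removed at the first stage that meets \<open>B\<close> is
      minimal.\<close>
    proof (cases "x \<in> topspace X")
      case False
      then show ?thesis
        using x by (auto simp: R_def)
    next
      case True
      then have "i0 \<in> {i. B \<inter> G i \<noteq> {}}"
        using x i0 GS by blast
      from wfE_min[OF wfQ this]
      obtain i where "i \<in> {i. B \<inter> G i \<noteq> {}}" "\<And>j. (j, i) \<in> Q \<Longrightarrow> j \<notin> {i. B \<inter> G i \<noteq> {}}"
        by metis
      then have i: "B \<inter> G i \<noteq> {}" "\<And>j. (j, i) \<in> Q \<Longrightarrow> B \<inter> G j = {}"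
        by simp_all
      then obtain z where z: "z \<in> B" "z \<in> G i"
        by blast
      have "y \<notin> B" if yz: "(y, z) \<in> R" for y
      proof -
        obtain j where j: "y \<in> G j" "z \<notin> G j"
          using yz by (auto simp: R_def)
        have "(j, i) \<in> Q"
          using total[of i j] j z S_mono[of i j] GS[of j] by auto
        then show ?thesis
          using i(2) j(1) by blast
      qed
      then show ?thesis
        using z by blast
    qed
  qed
  moreover have "\<exists>U. openin X U \<and> y \<in> U \<and> (\<forall>z\<in>U. z \<noteq> y \<longrightarrow> (z, y) \<in> R)"
    if y: "y \<in> topspace X" for y
  proof -
    have "i0 \<in> {i. y \<in> G i}"
      using y i0 GS by blast
    from wfE_min[OF wfQ this]
    obtain i where "i \<in> {i. y \<in> G i}" "\<And>j. (j, i) \<in> Q \<Longrightarrow> j \<notin> {i. y \<in> G i}"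
      by metis
    then have i: "y \<in> G i" "\<And>j. (j, i) \<in> Q \<Longrightarrow> y \<notin> G j"
      by simp_all
    have "y \<notin> S i"
      using i(2) by (auto simp: S_def)
    then have "y \<in> iso (S i)"
      using i(1) GS by blast
    then obtain U where U: "openin X U" "{y} = U \<inter> (topspace X - S i)"
      unfolding iso_def openin_subtopology by blast
    have "(z, y) \<in> R" if "z \<in> U" "z \<noteq> y" for z
    proof -
      have "z \<in> S i"
        using U that openin_subset by fastforce
      then show ?thesis
        using i(2) y unfolding S_def R_def by blast
    qed
    then show ?thesis
      using U by blast
  qed
  ultimately show ?thesis
    using that by blast
qed

section \<open>Strategies\<close>

text \<open>If after every position in \<open>B\<close> player II had an answer in \<open>B\<close>
  outside \<open>W\<close>, giving these answers forever would defeat the winning strategy. The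
  moves thus come from a prescribed set, at the price of controlling the neighbourhood only inside
  that set.\<close>

lemma W_strategy_restricted_cofinal:
  assumes win: "W_winning_strategy X y \<sigma>" and B: "B \<subseteq> topspace X"
    and W: "openin X W" "y \<in> W"
  obtains s where "set s \<subseteq> B" "\<sigma> s \<inter> B \<subseteq> W"
proof -
  have False if no: "\<And>s. set s \<subseteq> B \<Longrightarrow> \<not> \<sigma> s \<inter> B \<subseteq> W"
  proof -
    have "\<exists>b. set s \<subseteq> B \<longrightarrow> b \<in> \<sigma> s \<inter> B - W" for s
      using no by blast
    then obtain g where g: "\<And>s. set s \<subseteq> B \<Longrightarrow> g s \<in> \<sigma> s \<inter> B - W"
      by metis
    \<comment> \<open>\<open>L n\<close> is the list of the first \<open>n\<close> answers that
      \<open>g\<close> gives against the strategy.\<close>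
    define L where "L = rec_nat [] (\<lambda>_ l. l @ [g l])"
    define a where "a n = g (L n)" for n
    have L: "L n = map a [0..<n]" for n
      by (induction n) (simp_all add: L_def a_def)
    have LB: "set (L n) \<subseteq> B" for n
    proof (induction n)
      case (Suc n)
      then show ?case using g[of "L n"] by (simp add: L_def)
    qed (simp add: L_def)
    have a: "a n \<in> \<sigma> (map a [0..<n])" "a n \<in> B" "a n \<notin> W" for n
      using g[OF LB[of n]] by (simp_all add: a_def flip: L)
    then have "limitin X a y sequentially"
      using win B unfolding W_winning_strategy_def by blast
    then have "\<forall>\<^sub>F n in sequentially. a n \<in> W"
      using W by (simp add: limitin_def)
    then show False
      using a(3) by (auto simp: eventually_sequentially)
  qed
  then show ?thesis
    using that by blast
qed

text \<open>A winning strategy stays winning when its neighbourhoods shrink, so the answer at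
  \<open>y\<close> may also avoid a neighbourhood of every earlier move other than
  \<open>y\<close>.\<close>

lemma W_space_separating_strategies:
  assumes X: "Hausdorff_space X" "W_space X"
  obtains \<sigma> where "\<And>y. y \<in> topspace X \<Longrightarrow> W_winning_strategy X y (\<sigma> y)"
    "\<And>y z. y \<in> topspace X \<Longrightarrow> z \<in> topspace X \<Longrightarrow> y \<noteq> z \<Longrightarrow> \<sigma> y [z] \<inter> \<sigma> z [y] = {}"
proof -
  obtain \<tau> where \<tau>: "\<And>y. y \<in> topspace X \<Longrightarrow> W_winning_strategy X y (\<tau> y)"
    using X(2) unfolding W_space_def W_point_def by metis
  have "\<forall>y z. \<exists>A. y \<in> topspace X \<and> z \<in> topspace X \<and> y \<noteq> z \<longrightarrow>
      openin X (fst A) \<and> openin X (snd A) \<and> y \<in> fst A \<and> z \<in> snd A \<and> fst A \<inter> snd A = {}"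
    using X(1) unfolding Hausdorff_space_def disjnt_def by (metis fst_conv snd_conv)
  then obtain A where A: "\<And>y z. y \<in> topspace X \<Longrightarrow> z \<in> topspace X \<Longrightarrow> y \<noteq> z \<Longrightarrow>
      openin X (fst (A y z)) \<and> openin X (snd (A y z)) \<and> y \<in> fst (A y z) \<and> z \<in> snd (A y z) \<and>
      fst (A y z) \<inter> snd (A y z) = {}"
    by metis
  \<comment> \<open>The pairs \<open>A y z\<close> and \<open>A z y\<close> are chosen
    independently; intersecting their matching halves makes \<open>H y z\<close> and
    \<open>H z y\<close> disjoint.\<close>
  define H where "H y z = fst (A y z) \<inter> snd (A z y)" for y z
  have H: "openin X (H y z)" "y \<in> H y z" "H y z \<inter> H z y = {}"
    if "y \<in> topspace X" "z \<in> topspace X" "y \<noteq> z" for y z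
    using A[of y z] A[of z y] that by (auto simp: H_def)
  \<comment> \<open>Only finitely many sets are intersected, so the result is open; the factor
    \<open>topspace X\<close> serves the case where no move differs from \<open>y\<close>.\<close>
  define \<sigma> where "\<sigma> y s = \<tau> y s \<inter> (topspace X \<inter> \<Inter>((\<lambda>z. H y z) ` (set s - {y})))" for y s
  have "W_winning_strategy X y (\<sigma> y)" if y: "y \<in> topspace X" for y
  proof -
    have "openin X (\<sigma> y s) \<and> y \<in> \<sigma> y s" if s: "set s \<subseteq> topspace X" for s
    proof
      have \<tau>s: "openin X (\<tau> y s)" "y \<in> \<tau> y s"
        using \<tau>[OF y] s by (auto simp: W_winning_strategy_def W_strategy_def)
      have "openin X (topspace X \<inter> \<Inter>((\<lambda>z. H y z) ` (set s - {y})))"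
        using H(1)[OF y] s by (intro openin_Int_Inter) auto
      then show "openin X (\<sigma> y s)"
        unfolding \<sigma>_def using \<tau>s by blast
      show "y \<in> \<sigma> y s"
        unfolding \<sigma>_def using \<tau>s H(2)[OF y] s y by auto
    qed
    then show ?thesis
      using \<tau>[OF y] unfolding W_winning_strategy_def W_strategy_def by (auto simp: \<sigma>_def)
  qed
  moreover have "\<sigma> y [z] \<inter> \<sigma> z [y] = {}"
    if "y \<in> topspace X" "z \<in> topspace X" "y \<noteq> z" for y z
  proof -
    have "\<sigma> y [z] \<subseteq> H y z" "\<sigma> z [y] \<subseteq> H z y"
      using that by (auto simp: \<sigma>_def)
    then show ?thesis
      using H(3)[OF that] by blast
  qed
  ultimately show ?thesis
    by (rule that)
qed

lemma Lindelof_space_closedin_countable_cover: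
  assumes "Lindelof_space X" "closedin X F" and V: "\<And>c. c \<in> F \<Longrightarrow> openin X (V c) \<and> c \<in> V c"
  obtains D where "countable D" "D \<subseteq> F" "F \<subseteq> (\<Union>c\<in>D. V c)"
proof -
  have "F \<subseteq> topspace X"
    using assms(2) closedin_subset by blast
  moreover have "Lindelof_space (subtopology X F)"
    using assms Lindelof_space_closedin_subtopology by blast
  ultimately have *: "\<forall>\<U>. (\<forall>U\<in>\<U>. openin X U) \<and> F \<subseteq> \<Union>\<U> \<longrightarrow> (\<exists>\<V>. countable \<V> \<and> \<V> \<subseteq> \<U> \<and> F \<subseteq> \<Union>\<V>)"
    by (simp add: Lindelof_space_subtopology_subset)
  have "\<exists>\<V>. countable \<V> \<and> \<V> \<subseteq> V ` F \<and> F \<subseteq> \<Union>\<V>"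
    using V by (intro *[THEN spec, THEN mp]) blast
  then show ?thesis
    using that by (metis countable_subset_image)
qed


section \<open>Sets closed under the covering operation\<close>

lemma compactin_sequence_cluster:
  fixes q :: "nat \<Rightarrow> 'a"
  assumes K: "compactin X K" and q: "\<And>i. q i \<in> K"
  obtains x where "x \<in> K" "\<And>U. openin X U \<Longrightarrow> x \<in> U \<Longrightarrow> infinite {i. q i \<in> U}"
proof -
  have False if no: "\<And>x. x \<in> K \<Longrightarrow> \<exists>U. openin X U \<and> x \<in> U \<and> finite {i. q i \<in> U}"
  proof -
    let ?\<U> = "{U. openin X U \<and> finite {i. q i \<in> U}}"
    have "K \<subseteq> \<Union>?\<U>" "\<forall>U\<in>?\<U>. openin X U"
      using no by blast+
    then obtain \<F> where \<F>: "finite \<F>" "\<F> \<subseteq> ?\<U>" "K \<subseteq> \<Union>\<F>"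
      using K unfolding compactin_def by meson
    have "finite (\<Union>U\<in>\<F>. {i. q i \<in> U})"
      using \<F> by blast
    moreover have "UNIV \<subseteq> (\<Union>U\<in>\<F>. {i. q i \<in> U})"
      using q \<F>(3) by blast
    ultimately show False
      using finite_subset infinite_UNIV_nat by blast
  qed
  then show ?thesis
    using that by blast
qed

text \<open>Least elements of \<open>J\<close> are taken one after another. The invariant that only
  finitely many elements of \<open>J\<close> lie below the current one ensures that a next one
  exists.\<close>

lemma Well_order_infinite_increasing:
  assumes r: "Well_order r" and J: "J \<subseteq> Field r" "infinite J"
  obtains a :: "nat \<Rightarrow> 'i" where "\<And>i. a i \<in> J" "\<And>i j. i < j \<Longrightarrow> (a i, a j) \<in> r - Id"
proof -
  have wf: "wf (r - Id)" and lin: "Linear_order r"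
    using r by (simp_all add: well_order_on_def)
  then have tr: "trans r" and anti: "antisym r" and tot: "Total r"
    by (simp_all add: order_on_defs)
  define below where "below x = {b \<in> J. (b, x) \<in> r}" for x
  have next_elem: "\<exists>y\<in>A. \<forall>b. (b, y) \<in> r - Id \<longrightarrow> b \<notin> A" if A: "A \<noteq> {}" for A
  proof -
    obtain x where "x \<in> A"
      using A by blast
    from wfE_min[OF wf this] show ?thesis
      by metis
  qed
  have "\<exists>a. \<forall>n. (a n \<in> J \<and> finite (below (a n))) \<and> (a n, a (Suc n)) \<in> r - Id"
  proof (rule dependent_nat_choice)
    obtain y where y: "y \<in> J" "\<And>b. (b, y) \<in> r - Id \<Longrightarrow> b \<notin> J"
      using next_elem[of J] J(2) by auto
    then have "below y \<subseteq> {y}"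
      unfolding below_def by blast
    then show "\<exists>x. x \<in> J \<and> finite (below x)"
      using y finite_subset by blast
  next
    fix x and n :: nat
    assume x: "x \<in> J \<and> finite (below x)"
    then have "J - below x \<noteq> {}"
      using J(2) by (metis Diff_eq_empty_iff finite_subset)
    then obtain y where y: "y \<in> J" "y \<notin> below x" "\<And>b. (b, y) \<in> r - Id \<Longrightarrow> b \<notin> J - below x"
      using next_elem[of "J - below x"] by blast
    have "below y \<subseteq> insert y (below x)"
      using y(3) unfolding below_def by blast
    then have "finite (below y)"
      using x finite_subset by blast
    moreover have "(y, x) \<notin> r"
      using y by (simp add: below_def)
    moreover have "x \<noteq> y"
      using lin y x J(1) unfolding below_def by (auto simp: order_on_defs refl_on_def)
    then have "(x, y) \<in> r - Id"
      using tot \<open>(y, x) \<notin> r\<close> y x J(1) unfolding total_on_def by blast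
    ultimately show "\<exists>y. (y \<in> J \<and> finite (below y)) \<and> (x, y) \<in> r - Id"
      using y by blast
  qed
  then obtain a where a: "\<And>n. a n \<in> J" "\<And>n. (a n, a (Suc n)) \<in> r - Id"
    by blast
  have trd: "trans (r - Id)"
    using tr anti by (simp add: trans_diff_Id)
  have "(a i, a (Suc (i + k))) \<in> r - Id" for i k
  proof (induction k)
    case 0
    then show ?case using a(2)[of i] by simp
  next
    case (Suc k)
    then show ?case
      using a(2)[of "Suc (i + k)"] trd by (metis add_Suc_right transD)
  qed
  then have "i < j \<Longrightarrow> (a i, a j) \<in> r - Id" for i j
    using less_iff_Suc_add by auto
  then show ?thesis
    using that a(1) by blast
qed

lemma card_of_lists_ordLeq_infinite:
  assumes B: "infinite B" and S: "|S| \<le>o |B|"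
  shows "|{l. set l \<subseteq> S}| \<le>o |B|"
proof -
  have len: "|{l. set l \<subseteq> S \<and> length l = n}| \<le>o |B|" for n
  proof (induction n)
    case 0
    have "{l. set l \<subseteq> S \<and> length l = 0} = {[]}"
      by auto
    then show ?case
      using B by (metis card_of_ordLeq_finite card_of_ordLeq_infinite card_of_singl_ordLeq
          finite.emptyI)
  next
    case (Suc n)
    let ?A = "{l. set l \<subseteq> S \<and> length l = n}"
    have "{l. set l \<subseteq> S \<and> length l = Suc n} \<subseteq> (\<lambda>(x, l). x # l) ` (S \<times> ?A)"
      by (force simp: length_Suc_conv image_iff)
    then have "|{l. set l \<subseteq> S \<and> length l = Suc n}| \<le>o |S \<times> ?A|"
      using surj_imp_ordLeq by blast
    also have "|S \<times> ?A| \<le>o |B|"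
      using B S Suc by (intro card_of_Times_ordLeq_infinite_Field) (simp_all add: Field_card_of card_of_card_order_on)
    finally show ?case .
  qed
  have "{l. set l \<subseteq> S} = (\<Union>n. {l. set l \<subseteq> S \<and> length l = n})"
    by auto
  moreover have "|\<Union>n. {l. set l \<subseteq> S \<and> length l = n}| \<le>o |B|"
    using B len by (intro card_of_UNION_ordLeq_infinite) (auto simp flip: infinite_iff_card_of_nat)
  ultimately show ?thesis
    by simp
qed

text \<open>The game-theoretic data on which the remaining argument rests. Lindelofness and
  scatteredness enter through \<open>countable_op\<close> and \<open>nearest\<close>;
  \<open>nested\<close> stores in \<open>\<Phi>\<close> the moves that shrink a neighbourhood of
  \<open>z\<close> into a given neighbourhood of \<open>q\<close>.\<close>

locale W_skeleton =
  fixes X :: "'a topology" and \<sigma> :: "'a \<Rightarrow> 'a list \<Rightarrow> 'a set" and \<Phi> :: "'a list \<Rightarrow> 'a set"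
  assumes Hausdorff: "Hausdorff_space X"
    and winning: "y \<in> topspace X \<Longrightarrow> W_winning_strategy X y (\<sigma> y)"
    and separating: "y \<in> topspace X \<Longrightarrow> z \<in> topspace X \<Longrightarrow> y \<noteq> z \<Longrightarrow> \<sigma> y [z] \<inter> \<sigma> z [y] = {}"
    and countable_op: "countable (\<Phi> l)"
    and op_subset: "set l \<subseteq> topspace X \<Longrightarrow> \<Phi> l \<subseteq> topspace X"
    and nested: "z \<in> topspace X \<Longrightarrow> q \<in> topspace X \<Longrightarrow> set l \<subseteq> topspace X \<Longrightarrow> z \<in> \<sigma> q l \<Longrightarrow>
      \<exists>t. set t \<subseteq> \<Phi> (z # q # l) \<and> \<sigma> z t \<subseteq> \<sigma> q l"
    and nearest: "M \<subseteq> topspace X \<Longrightarrow> (\<And>l. set l \<subseteq> M \<Longrightarrow> \<Phi> l \<subseteq> M) \<Longrightarrow> p \<in> topspace X \<Longrightarrow>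
      \<exists>y\<in>M. \<forall>l. set l \<subseteq> M \<longrightarrow> p \<in> \<sigma> y l"
begin

text \<open>Closedness under the operation \<open>\<Phi>\<close>; topological closedness is a
  consequence, shown in \<open>skeletal_closedin\<close>.\<close>

definition skeletal :: "'a set \<Rightarrow> bool" where
  "skeletal M \<longleftrightarrow> M \<subseteq> topspace X \<and> (\<forall>l. set l \<subseteq> M \<longrightarrow> \<Phi> l \<subseteq> M)"

text \<open>For skeletal \<open>M\<close> the choice is unambiguous: two candidates \<open>y\<close>
  and \<open>z\<close> would put \<open>p\<close> into the disjoint sets
  \<open>\<sigma> y [z]\<close> and \<open>\<sigma> z [y]\<close>.\<close>

definition proj :: "'a set \<Rightarrow> 'a \<Rightarrow> 'a" where
  "proj M p = (SOME y. y \<in> M \<and> (\<forall>l. set l \<subseteq> M \<longrightarrow> p \<in> \<sigma> y l))"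

section \<open>Projections onto skeletal sets and their topology\<close>

lemma strategy_open:
  assumes "y \<in> topspace X" "set l \<subseteq> topspace X"
  shows "openin X (\<sigma> y l)" "y \<in> \<sigma> y l"
  using winning assms unfolding W_winning_strategy_def W_strategy_def by auto

lemma skeletal_subset: "skeletal M \<Longrightarrow> M \<subseteq> topspace X"
  by (simp add: skeletal_def)

lemma proj:
  assumes "skeletal M" "p \<in> topspace X"
  shows proj_in: "proj M p \<in> M" and in_strategy_proj: "set l \<subseteq> M \<Longrightarrow> p \<in> \<sigma> (proj M p) l"
proof -
  have "\<exists>y. y \<in> M \<and> (\<forall>l. set l \<subseteq> M \<longrightarrow> p \<in> \<sigma> y l)"
    using nearest[of M p] assms unfolding skeletal_def by blast
  from someI_ex[OF this] show "proj M p \<in> M" "set l \<subseteq> M \<Longrightarrow> p \<in> \<sigma> (proj M p) l"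
    by (auto simp: proj_def)
qed

text \<open>A point of \<open>M\<close> lies in all of its own neighbourhoods, so
  \<open>separating\<close> excludes any other candidate.\<close>

lemma proj_self:
  assumes M: "skeletal M" and p: "p \<in> M"
  shows "proj M p = p"
proof (rule ccontr)
  assume neq: "proj M p \<noteq> p"
  have pT: "p \<in> topspace X"
    using assms skeletal_subset by blast
  have "proj M p \<in> topspace X"
    using proj_in[OF M pT] M skeletal_subset by blast
  moreover have "p \<in> \<sigma> (proj M p) [p]"
    using in_strategy_proj[OF M pT, of "[p]"] p by simp
  moreover have "p \<in> \<sigma> p [proj M p]"
    using strategy_open(2)[OF pT, of "[proj M p]"] calculation(1) by simp
  ultimately show False
    using separating[OF _ pT neq] by blast
qed

text \<open>Transfers membership in a prescribed neighbourhood from the projection back to the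
  point: the moves supplied by \<open>nested\<close> belong to \<open>M\<close>, and
  \<open>p\<close> lies in every neighbourhood of its projection prescribed after moves in
  \<open>M\<close>.\<close>

lemma in_strategy_if_proj:
  assumes M: "skeletal M" and p: "p \<in> topspace X" and q: "q \<in> M" "set l \<subseteq> M"
    and proj: "proj M p \<in> \<sigma> q l"
  shows "p \<in> \<sigma> q l"
proof -
  have z: "proj M p \<in> M"
    using proj_in[OF M p] .
  obtain t where t: "set t \<subseteq> \<Phi> (proj M p # q # l)" "\<sigma> (proj M p) t \<subseteq> \<sigma> q l"
    using nested[of "proj M p" q l] z q proj skeletal_subset[OF M] by blast
  have "\<Phi> (proj M p # q # l) \<subseteq> M"
    using M z q unfolding skeletal_def by (metis insert_subset list.simps(15))
  then show ?thesis
    using in_strategy_proj[OF M p, of t] t by blast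
qed

text \<open>For \<open>q\<close> outside \<open>M\<close>, separate \<open>q\<close> from its
  projection \<open>y\<close> by \<open>U\<close> and \<open>W\<close>. After suitable moves in
  \<open>M\<close> the neighbourhood of \<open>y\<close> meets \<open>M\<close> only inside
  \<open>W\<close>, yet it contains \<open>q\<close>; intersected with \<open>U\<close> it misses
  \<open>M\<close>.\<close>

lemma skeletal_closedin:
  assumes M: "skeletal M"
  shows "closedin X M"
proof -
  have "\<exists>U. openin X U \<and> q \<in> U \<and> U \<subseteq> topspace X - M" if q: "q \<in> topspace X - M" for q
  proof -
    define y where "y = proj M q"
    have y: "y \<in> M" "y \<in> topspace X"
      using proj_in[OF M, of q] q skeletal_subset[OF M] unfolding y_def by blast+
    then have "q \<noteq> y"
      using q by blast
    with y(2) obtain U W where UW: "openin X U" "openin X W" "q \<in> U" "y \<in> W" "U \<inter> W = {}"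
      using Hausdorff q unfolding Hausdorff_space_def disjnt_def by (metis DiffD1)
    obtain s where s: "set s \<subseteq> M" "\<sigma> y s \<inter> M \<subseteq> W"
      using W_strategy_restricted_cofinal[OF winning[OF y(2)] skeletal_subset[OF M] UW(2,4)] .
    have "openin X (\<sigma> y s)"
      using s(1) skeletal_subset[OF M] by (intro strategy_open(1) y(2)) blast
    then have "openin X (U \<inter> \<sigma> y s)"
      using UW(1) by blast
    moreover have "q \<in> U \<inter> \<sigma> y s"
      using in_strategy_proj[OF M _ s(1), of q] q UW(3) by (simp add: y_def)
    moreover have "U \<inter> \<sigma> y s \<subseteq> topspace X - M"
      using s(2) UW(1,5) openin_subset by blast
    ultimately show ?thesis
      by blast
  qed
  then have "openin X (topspace X - M)"
    by (subst openin_subopen) blast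
  then show ?thesis
    using skeletal_subset[OF M] by (simp add: closedin_def)
qed

text \<open>If \<open>p\<close> projects to \<open>y\<close> outside \<open>C\<close>, finitely many
  sets \<open>\<sigma> c [y]\<close> cover \<open>C\<close>, and the corresponding sets
  \<open>\<sigma> y [c]\<close> intersect in a neighbourhood of \<open>p\<close>. A point of it
  projecting into \<open>C\<close> would lie in both \<open>\<sigma> c [y]\<close> and
  \<open>\<sigma> y [c]\<close> for some \<open>c\<close>.\<close>

lemma closedin_proj_vimage:
  assumes M: "skeletal M" and C: "compactin X C" "C \<subseteq> M"
  shows "closedin X {p \<in> topspace X. proj M p \<in> C}"
proof -
  have "\<exists>U. openin X U \<and> p \<in> U \<and> U \<subseteq> topspace X - {p \<in> topspace X. proj M p \<in> C}"
    if p: "p \<in> topspace X" "proj M p \<notin> C" for p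
  proof -
    define y where "y = proj M p"
    have y: "y \<in> M" "y \<in> topspace X"
      using proj_in[OF M] p skeletal_subset[OF M] by (auto simp: y_def)
    have CT: "c \<in> topspace X" if "c \<in> C" for c
      using that C(2) skeletal_subset[OF M] by blast
    have "\<forall>U\<in>(\<lambda>c. \<sigma> c [y]) ` C. openin X U" "C \<subseteq> \<Union>((\<lambda>c. \<sigma> c [y]) ` C)"
      using strategy_open[of _ "[y]"] y(2) CT by auto
    then obtain \<F> where "finite \<F>" "\<F> \<subseteq> (\<lambda>c. \<sigma> c [y]) ` C" "C \<subseteq> \<Union>\<F>"
      using C(1) unfolding compactin_def by meson
    then obtain D where D: "finite D" "D \<subseteq> C" "C \<subseteq> (\<Union>c\<in>D. \<sigma> c [y])"
      by (metis finite_subset_image)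
    define U where "U = topspace X \<inter> \<Inter>((\<lambda>c. \<sigma> y [c]) ` D)"
    have "openin X U"
      unfolding U_def using D strategy_open(1)[OF y(2)] CT by (intro openin_Int_Inter) auto
    moreover have "p \<in> U"
      using in_strategy_proj[OF M p(1)] D(2) C(2) p(1) by (auto simp: U_def y_def)
    moreover have "proj M q \<notin> C" if q: "q \<in> U" for q
    proof
      assume "proj M q \<in> C"
      then obtain c where c: "c \<in> D" "proj M q \<in> \<sigma> c [y]"
        using D(3) by blast
      then have "q \<in> \<sigma> c [y]"
        using in_strategy_if_proj[OF M, of q c "[y]"] q y(1) D(2) C(2) by (auto simp: U_def)
      moreover have "q \<in> \<sigma> y [c]"
        using q c(1) by (auto simp: U_def)
      moreover have "c \<noteq> y"
        using c(1) D(2) p(2) by (auto simp: y_def)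
      ultimately show False
        using separating[of c y] CT c(1) D(2) y(2) by blast
    qed
    ultimately show ?thesis
      using openin_subset by blast
  qed
  then have "openin X (topspace X - {p \<in> topspace X. proj M p \<in> C})"
    by (subst openin_subopen) blast
  then show ?thesis
    by (simp add: closedin_def)
qed

text \<open>A list has finitely many entries and so lies in a single member of the chain.\<close>

lemma skeletal_Union_chain:
  assumes C: "C \<noteq> {}" "\<And>A. A \<in> C \<Longrightarrow> skeletal A" "\<And>A B. A \<in> C \<Longrightarrow> B \<in> C \<Longrightarrow> A \<subseteq> B \<or> B \<subseteq> A"
  shows "skeletal (\<Union>C)"
  unfolding skeletal_def
proof (intro conjI allI impI)
  show "\<Union>C \<subseteq> topspace X"
    using C(2) skeletal_subset by blast
  fix l assume l: "set l \<subseteq> \<Union>C"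
  have "subset.chain C C"
    using C(3) unfolding subset_chain_def by blast
  then obtain B where "B \<in> C" "set l \<subseteq> B"
    using finite_subset_Union_chain[OF _ l C(1)] by blast
  then show "\<Phi> l \<subseteq> \<Union>C"
    using C(2) unfolding skeletal_def by blast
qed

text \<open>If infinitely many of the added pieces were to leave an open neighbourhood \<open>W\<close> of \<open>K\<close>, points
  \<open>p\<^sub>i\<close> outside \<open>W\<close> with increasing indices would project to a sequence in \<open>K\<close> with a cluster
  point \<open>x\<close>. Every neighbourhood of \<open>x\<close> prescribed by the strategy after moves among the \<open>p\<^sub>i\<close>
  then contains a further \<open>p\<^sub>i\<close>, so that player II wins at \<open>x\<close>.\<close>

lemma compactin_proj_extension:
  fixes N N' E :: "'i \<Rightarrow> 'a set"
  assumes r: "Well_order r"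
    and N: "\<And>a. a \<in> Field r \<Longrightarrow> skeletal (N a)" "\<And>a. a \<in> Field r \<Longrightarrow> N a \<subseteq> N' a"
      "\<And>a b. (a, b) \<in> r - Id \<Longrightarrow> N' a \<subseteq> N b"
    and E: "\<And>a. a \<in> Field r \<Longrightarrow> compactin X (E a)" "\<And>a. a \<in> Field r \<Longrightarrow> E a \<subseteq> N' a"
    and K: "compactin X K"
  shows "compactin X (K \<union> (\<Union>a\<in>Field r. {p \<in> E a. proj (N a) p \<in> K}))"
proof -
  define L where "L a = {p \<in> E a. proj (N a) p \<in> K}" for a
  have ET: "E a \<subseteq> topspace X" if "a \<in> Field r" for a
    using E(1) that compactin_subset_topspace by blast
  have L_compact: "compactin X (L a)" if a: "a \<in> Field r" for a
  proof -
    have "compactin X (N a \<inter> K)"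
      using closed_Int_compactin[OF skeletal_closedin[OF N(1)[OF a]] K] .
    then have "closedin X {p \<in> topspace X. proj (N a) p \<in> N a \<inter> K}"
      by (rule closedin_proj_vimage[OF N(1)[OF a]]) blast
    then have "compactin X ({p \<in> topspace X. proj (N a) p \<in> N a \<inter> K} \<inter> E a)"
      using closed_Int_compactin E(1)[OF a] by blast
    \<comment> \<open>Values of \<open>proj (N a)\<close> lie in \<open>N a\<close>, so replacing
      \<open>K\<close> by the compact set \<open>N a \<inter> K\<close> changes nothing.\<close>
    moreover have "L a = {p \<in> topspace X. proj (N a) p \<in> N a \<inter> K} \<inter> E a"
      using proj_in[OF N(1)[OF a]] ET[OF a] by (auto simp: L_def)
    ultimately show ?thesis
      by simp
  qed
  have finite_J: "finite {a \<in> Field r. \<not> L a \<subseteq> W}" if W: "openin X W" "K \<subseteq> W" for W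
  proof (rule ccontr)
    assume inf: "infinite {a \<in> Field r. \<not> L a \<subseteq> W}"
    have sub: "{a \<in> Field r. \<not> L a \<subseteq> W} \<subseteq> Field r"
      by blast
    obtain a :: "nat \<Rightarrow> 'i" where a: "\<And>i. a i \<in> {a \<in> Field r. \<not> L a \<subseteq> W}"
      and a_incr: "\<And>i j. i < j \<Longrightarrow> (a i, a j) \<in> r - Id"
      by (rule Well_order_infinite_increasing[OF r sub inf]) (rule that)
    have aF: "a i \<in> Field r" for i
      using a by blast
    have "\<exists>p. p \<in> L (a i) \<and> p \<notin> W" for i
      using a by blast
    then obtain p where p: "\<And>i. p i \<in> L (a i)" "\<And>i. p i \<notin> W"
      by metis
    have pT: "p i \<in> topspace X" for i
      using p(1)[of i] ET[OF aF] by (auto simp: L_def)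
    have pN: "p i \<in> N (a j)" if "i < j" for i j
      using p(1)[of i] E(2)[OF aF[of i]] N(3)[OF a_incr[OF that]] by (auto simp: L_def)
    have N_mono: "N (a i) \<subseteq> N (a j)" if "i \<le> j" for i j
      using that N(2)[OF aF[of i]] N(3)[OF a_incr, of i j] by (cases "i = j") auto
    \<comment> \<open>The union of the chain is closed, so the part of \<open>K\<close> in it is
      compact and the cluster point \<open>x\<close> already lies in some
      \<open>N (a j)\<close>.\<close>
    have "skeletal (\<Union>(range (\<lambda>i. N (a i))))"
    proof (rule skeletal_Union_chain)
      have "N (a i) \<subseteq> N (a j) \<or> N (a j) \<subseteq> N (a i)" for i j
        using N_mono[of i j] N_mono[of j i] nat_le_linear[of i j] by argo
      then show "A \<subseteq> B \<or> B \<subseteq> A" if "A \<in> range (\<lambda>i. N (a i))" "B \<in> range (\<lambda>i. N (a i))" for A B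
        using that by (elim rangeE) simp
    qed (use N(1)[OF aF] in auto)
    then have "compactin X ((\<Union>i. N (a i)) \<inter> K)"
      using closed_Int_compactin skeletal_closedin K by blast
    moreover have "proj (N (a i)) (p i) \<in> (\<Union>i. N (a i)) \<inter> K" for i
      using p(1)[of i] proj_in[OF N(1)[OF aF] pT, of i i] by (auto simp: L_def)
    ultimately obtain x where x: "x \<in> (\<Union>i. N (a i)) \<inter> K"
      and cluster: "\<And>U. openin X U \<Longrightarrow> x \<in> U \<Longrightarrow> infinite {i. proj (N (a i)) (p i) \<in> U}"
      using compactin_sequence_cluster[of X _ "\<lambda>i. proj (N (a i)) (p i)"] by blast
    obtain j where j: "x \<in> N (a j)"
      using x by blast
    have xT: "x \<in> topspace X"
      using j skeletal_subset N(1) aF by blast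
    have "p ` {j..} \<subseteq> topspace X"
      using pT by blast
    then obtain s where s: "set s \<subseteq> p ` {j..}" "\<sigma> x s \<inter> p ` {j..} \<subseteq> W"
      using W_strategy_restricted_cofinal[OF winning[OF xT]] W x by blast
    obtain D where D: "finite D" "set s = p ` D"
      using s(1) by (metis List.finite_set finite_subset_image)
    have "set s \<subseteq> topspace X"
      using s(1) pT by blast
    then have "infinite {i. proj (N (a i)) (p i) \<in> \<sigma> x s}"
      using cluster strategy_open[OF xT] by blast
    \<comment> \<open>Beyond \<open>j\<close> and all indices of moves in \<open>s\<close>, both
      \<open>x\<close> and the entries of \<open>s\<close> lie in \<open>N (a i)\<close>, as
      \<open>in_strategy_if_proj\<close> requires.\<close>
    then have "infinite ({i. proj (N (a i)) (p i) \<in> \<sigma> x s} - {..Max (insert j D)})"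
      by (intro Diff_infinite_finite) auto
    then obtain i where i: "proj (N (a i)) (p i) \<in> \<sigma> x s" "Max (insert j D) < i"
      by (metis (no_types, lifting) Diff_iff atMost_iff finite.emptyI ex_in_conv linorder_not_le mem_Collect_eq)
    have i_large: "j < i" "\<And>k. k \<in> D \<Longrightarrow> k < i"
      using i(2) D(1) by (auto simp: Max_less_iff)
    have "p i \<in> \<sigma> x s"
    proof (rule in_strategy_if_proj[OF N(1)[OF aF] pT _ _ i(1)])
      show "x \<in> N (a i)"
        using j N_mono[of j i] i_large(1) by auto
      show "set s \<subseteq> N (a i)"
        using D(2) pN i_large(2) by auto
    qed
    then have "p i \<in> W"
      using s(2) i_large(1) by auto
    then show False
      using p(2) by blast
  qed
  have "compactin X (K \<union> (\<Union>a\<in>Field r. L a))"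
    unfolding compactin_def
  proof (intro conjI allI impI)
    show "K \<union> (\<Union>a\<in>Field r. L a) \<subseteq> topspace X"
      using K L_compact compactin_subset_topspace by blast
    fix \<U> assume \<U>: "(\<forall>U\<in>\<U>. openin X U) \<and> K \<union> (\<Union>a\<in>Field r. L a) \<subseteq> \<Union>\<U>"
    then obtain \<F> where \<F>: "finite \<F>" "\<F> \<subseteq> \<U>" "K \<subseteq> \<Union>\<F>"
      using K unfolding compactin_def by (meson le_sup_iff)
    \<comment> \<open>The union of a finite subcover of \<open>K\<close> acts as \<open>W\<close> in
      \<open>finite_J\<close>: only finitely many compact pieces are left to cover.\<close>
    have "openin X (\<Union>\<F>)"
      using \<U> \<F>(2) by blast
    then have fin: "finite {a \<in> Field r. \<not> L a \<subseteq> \<Union>\<F>}" (is "finite ?J")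
      using finite_J \<F>(3) by blast
    have "compactin X (\<Union>(L ` ?J))"
      using fin L_compact by (intro compactin_Union) auto
    moreover have "\<Union>(L ` ?J) \<subseteq> \<Union>\<U>"
      using \<U> by blast
    ultimately obtain \<G> where \<G>: "finite \<G>" "\<G> \<subseteq> \<U>" "\<Union>(L ` ?J) \<subseteq> \<Union>\<G>"
      using \<U> unfolding compactin_def by meson
    have "K \<union> (\<Union>a\<in>Field r. L a) \<subseteq> \<Union>(\<F> \<union> \<G>)"
      using \<F>(3) \<G>(3) by blast
    then show "\<exists>\<F>. finite \<F> \<and> \<F> \<subseteq> \<U> \<and> K \<union> (\<Union>a\<in>Field r. L a) \<subseteq> \<Union>\<F>"
      using \<F> \<G> by (metis finite_Un le_sup_iff)
  qed
  then show ?thesis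
    by (simp add: L_def)
qed

section \<open>Small closed sets\<close>

definition skeletal_hull_step :: "'a set \<Rightarrow> 'a set" where
  "skeletal_hull_step A = A \<union> \<Union>(\<Phi> ` {l. set l \<subseteq> A})"

text \<open>Countably many rounds suffice because each list of elements already appears at a finite
  stage.\<close>

definition skeletal_hull :: "'a set \<Rightarrow> 'a set" where
  "skeletal_hull A = (\<Union>n. (skeletal_hull_step ^^ n) A)"

lemma skeletal_hull_superset: "A \<subseteq> skeletal_hull A"
proof -
  have "(skeletal_hull_step ^^ 0) A \<subseteq> skeletal_hull A"
    unfolding skeletal_hull_def by blast
  then show ?thesis
    by simp
qed

lemma skeletal_hull_least:
  assumes "skeletal M" "A \<subseteq> M"
  shows "skeletal_hull A \<subseteq> M"
proof -
  have "(skeletal_hull_step ^^ n) A \<subseteq> M" for n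
  proof (induction n)
    case (Suc n)
    then have "\<Union>(\<Phi> ` {l. set l \<subseteq> (skeletal_hull_step ^^ n) A}) \<subseteq> M"
      using assms(1) unfolding skeletal_def by blast
    then show ?case
      using Suc by (simp add: skeletal_hull_step_def[of "(skeletal_hull_step ^^ n) A"])
  qed (use assms in simp)
  then show ?thesis
    by (auto simp: skeletal_hull_def)
qed

lemma skeletal_skeletal_hull:
  assumes A: "A \<subseteq> topspace X"
  shows "skeletal (skeletal_hull A)"
  unfolding skeletal_def
proof (intro conjI allI impI)
  have "skeletal (topspace X)"
    using op_subset by (simp add: skeletal_def)
  then show "skeletal_hull A \<subseteq> topspace X"
    using skeletal_hull_least A by blast
  fix l assume l: "set l \<subseteq> skeletal_hull A"
  have "(skeletal_hull_step ^^ n) A \<subseteq> (skeletal_hull_step ^^ m) A" if "n \<le> m" for n m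
    using that by (rule lift_Suc_mono_le[rotated]) (auto simp: skeletal_hull_step_def)
  then have "(skeletal_hull_step ^^ n) A \<subseteq> (skeletal_hull_step ^^ m) A \<or> (skeletal_hull_step ^^ m) A \<subseteq> (skeletal_hull_step ^^ n) A" for n m
    using nat_le_linear[of n m] by blast
  then have "subset.chain UNIV (range (\<lambda>n. (skeletal_hull_step ^^ n) A))"
    unfolding subset_chain_def by blast
  then obtain n where "set l \<subseteq> (skeletal_hull_step ^^ n) A"
    using finite_subset_Union_chain[OF List.finite_set l[unfolded skeletal_hull_def]] by blast
  then have "\<Phi> l \<subseteq> (skeletal_hull_step ^^ Suc n) A"
    by (auto simp: skeletal_hull_step_def)
  then show "\<Phi> l \<subseteq> skeletal_hull A"
    unfolding skeletal_hull_def by blast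
qed

lemma skeletal_hull_mono:
  assumes "A \<subseteq> B" "B \<subseteq> topspace X"
  shows "skeletal_hull A \<subseteq> skeletal_hull B"
  using skeletal_hull_least[OF skeletal_skeletal_hull] assms skeletal_hull_superset[of B] by simp

text \<open>Each round adds one countable set per list, and there are at most \<open>|B|\<close>
  lists. The separate infinite bound \<open>B\<close> also covers finite \<open>A\<close>.\<close>

lemma card_of_skeletal_hull:
  assumes B: "infinite B" and A: "|A| \<le>o |B|"
  shows "|skeletal_hull A| \<le>o |B|"
proof -
  have \<Phi>: "|\<Phi> l| \<le>o |B|" for l
  proof -
    obtain f :: "'a \<Rightarrow> nat" where "inj_on f (\<Phi> l)"
      using countable_op unfolding countable_def by blast
    then have "|\<Phi> l| \<le>o |UNIV :: nat set|"
      using card_of_ordLeqI by blast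
    then show ?thesis
      using B infinite_iff_card_of_nat ordLeq_transitive by blast
  qed
  have "|(skeletal_hull_step ^^ n) A| \<le>o |B|" for n
  proof (induction n)
    case (Suc n)
    let ?S = "(skeletal_hull_step ^^ n) A"
    have "|\<Union>(\<Phi> ` {l. set l \<subseteq> ?S})| \<le>o |B|"
      using B card_of_lists_ordLeq_infinite[OF B Suc] \<Phi>
      by (intro card_of_UNION_ordLeq_infinite) auto
    then show ?case
      using B Suc unfolding funpow.simps comp_apply skeletal_hull_step_def[of ?S]
      by (intro card_of_Un_ordLeq_infinite_Field) (simp_all add: Field_card_of card_of_card_order_on)
  qed (use A in simp)
  then show ?thesis
    unfolding skeletal_hull_def using B
    by (intro card_of_UNION_ordLeq_infinite) (auto simp flip: infinite_iff_card_of_nat)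
qed

text \<open>Along a well-ordering of \<open>M\<close> of minimal length, every \<open>p\<close> reaches the countable set \<open>skeletal_hull {}\<close> by
  finitely many projections \<open>p \<mapsto> proj (N a) p\<close> with decreasing \<open>a\<close>. The compact set \<open>K m n\<close> collects the
  points for which \<open>m\<close> projections suffice and all points met lie in the \<open>n\<close>-th compact pieces.\<close>

lemma skeletal_sigma_compact:
  assumes "skeletal M"
  shows "\<exists>E :: nat \<Rightarrow> 'a set. (\<forall>n. compactin X (E n)) \<and> mono E \<and> \<Union>(range E) = M"
  using assms
proof (induction "|M|" arbitrary: M rule: wf_induct_rule[OF wf_ordLess])
  case (1 M)
  note IH = 1(1) and M = 1(2)
  have countable_case: "\<exists>E :: nat \<Rightarrow> 'a set. (\<forall>n. compactin X (E n)) \<and> mono E \<and> \<Union>(range E) = A"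
    if A: "countable A" "A \<subseteq> topspace X" for A
  proof (cases "A = {}")
    case True
    then show ?thesis
      by (intro exI[of _ "\<lambda>_. {}"]) (auto simp: mono_def)
  next
    case False
    then obtain f :: "nat \<Rightarrow> 'a" where f: "range f = A"
      using A(1) uncountable_def by blast
    have "compactin X (f ` {..n})" for n
      using f A(2) by (intro finite_imp_compactin) auto
    moreover have "mono (\<lambda>n. f ` {..n})"
      by (intro monoI image_mono) auto
    moreover have "(\<Union>n. f ` {..n}) = A"
      using f by auto
    ultimately show ?thesis
      by (intro exI[of _ "\<lambda>n. f ` {..n}"]) blast
  qed
  show ?case
  proof (cases "countable M")
    case True
    then show ?thesis
      using countable_case M skeletal_subset by blast
  next
    case False
    \<comment> \<open>The cardinal \<open>|M|\<close> is itself a well-ordering of \<open>M\<close>,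
      and its proper initial segments have smaller cardinality than \<open>M\<close>.\<close>
    define r where "r = |M|"
    have r: "Well_order r" "Card_order r" "Field r = M"
      by (simp_all add: r_def card_of_well_order_on card_of_card_order_on Field_card_of)
    have wf: "wf (r - Id)" and lin: "Linear_order r"
      using r(1) by (simp_all add: well_order_on_def)
    then have tr: "trans r" and anti: "antisym r" and tot: "Total r"
      by (simp_all add: order_on_defs)
    have MT: "M \<subseteq> topspace X"
      using M skeletal_subset by blast
    have below: "underS r a \<subseteq> M" for a
      using r(3) by (auto simp: underS_def Field_def)
    \<comment> \<open>\<open>N a\<close> is generated by the predecessors of \<open>a\<close> alone,
      \<open>N' a\<close> by \<open>a\<close> as well. Points of \<open>N' a\<close> will be
      projected to \<open>N a\<close>.\<close>
    define N where "N a = skeletal_hull (underS r a)" for a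
    define N' where "N' a = skeletal_hull (insert a (underS r a))" for a
    have N: "skeletal (N a)" for a
      using below MT by (auto simp: N_def intro!: skeletal_skeletal_hull)
    have N': "skeletal (N' a)" "N' a \<subseteq> M" if "a \<in> M" for a
    proof -
      have sub: "insert a (underS r a) \<subseteq> M"
        using below that by blast
      show "skeletal (N' a)" "N' a \<subseteq> M"
        using skeletal_skeletal_hull[OF order_trans[OF sub MT]] skeletal_hull_least[OF M sub]
        by (simp_all add: N'_def)
    qed
    have NN': "N a \<subseteq> N' a" if "a \<in> M" for a
      unfolding N_def N'_def using that below MT by (intro skeletal_hull_mono) blast+
    have N'N: "N' a \<subseteq> N b" if ab: "(a, b) \<in> r - Id" for a b
    proof -
      have "insert a (underS r a) \<subseteq> underS r b"
        using ab tr anti unfolding underS_def by (auto dest: transD antisymD)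
      then show ?thesis
        unfolding N_def N'_def using below MT by (intro skeletal_hull_mono) blast+
    qed
    have nat_less: "|UNIV :: nat set| <o |M|"
    proof -
      have "\<not> |M| \<le>o |UNIV :: nat set|"
        using False unfolding countable_def by (meson card_of_ordLeq subset_UNIV)
      then show ?thesis
        by (rule not_ordLeq_iff_ordLess[THEN iffD1, OF card_of_Well_order card_of_Well_order])
    qed
    have fin_less: "|A| <o |B|" if "finite A" "infinite B" for A :: "'a set" and B :: "'a set"
      using that by (intro finite_ordLess_infinite) (simp_all add: Field_card_of card_of_well_order_on)
    have fin_less_nat: "|A| <o |UNIV :: nat set|" if "finite A" for A :: "'a set"
      using that by (intro finite_ordLess_infinite) (simp_all add: Field_card_of card_of_well_order_on)
    have N'_small: "|N' a| <o |M|" if a: "a \<in> M" for a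
    \<comment> \<open>The hull of a finite set is countable, hence smaller than the uncountable
      \<open>M\<close>; the hull of an infinite set is no larger than the set itself.\<close>
    proof (cases "finite (underS r a)")
      case True
      then have "|insert a (underS r a)| \<le>o |UNIV :: nat set|"
        by (intro ordLess_imp_ordLeq fin_less_nat) simp
      then have "|N' a| \<le>o |UNIV :: nat set|"
        unfolding N'_def by (intro card_of_skeletal_hull) auto
      then show ?thesis
        using nat_less ordLeq_ordLess_trans by blast
    next
      case inf: False
      have "|{a} \<union> underS r a| <o |M|"
      proof (rule card_of_Un_ordLess_infinite)
        show "infinite M"
          using False uncountable_infinite by blast
        then show "|{a}| <o |M|"
          by (intro fin_less) auto
        show "|underS r a| <o |M|"
          using card_of_underS[OF r(2)] a r(3) unfolding r_def by blast
      qed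
      moreover have "|N' a| \<le>o |insert a (underS r a)|"
        unfolding N'_def using inf by (intro card_of_skeletal_hull card_of_mono1) auto
      ultimately show ?thesis
        using ordLeq_ordLess_trans by fastforce
    qed
    have "\<exists>E :: nat \<Rightarrow> 'a set. (\<forall>n. compactin X (E n)) \<and> mono E \<and> \<Union>(range E) = N' a"
      if "a \<in> M" for a
      using IH[OF N'_small[OF that] N'(1)[OF that]] .
    then obtain E :: "'a \<Rightarrow> nat \<Rightarrow> 'a set" where
      E: "\<And>a n. a \<in> M \<Longrightarrow> compactin X (E a n)" "\<And>a. a \<in> M \<Longrightarrow> mono (E a)"
        "\<And>a. a \<in> M \<Longrightarrow> \<Union>(range (E a)) = N' a"
      by metis
    have "|skeletal_hull {}| \<le>o |UNIV :: nat set|"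
      by (intro card_of_skeletal_hull ordLess_imp_ordLeq fin_less_nat) auto
    then have "countable (skeletal_hull {})"
      unfolding countable_def card_of_ordLeq[symmetric] by auto
    moreover have skeletal_hull_empty: "skeletal (skeletal_hull {})"
      by (simp add: skeletal_skeletal_hull)
    ultimately have "\<exists>E :: nat \<Rightarrow> 'a set. (\<forall>n. compactin X (E n)) \<and> mono E \<and> \<Union>(range E) = skeletal_hull {}"
      using countable_case skeletal_subset by simp
    then obtain E0 :: "nat \<Rightarrow> 'a set" where
      E0: "\<And>n. compactin X (E0 n)" "mono E0" "\<Union>(range E0) = skeletal_hull {}"
      by blast
    define K where "K = rec_nat E0 (\<lambda>m Km n. Km n \<union> (\<Union>a\<in>M. {p \<in> E a n. proj (N a) p \<in> Km n}))"
    have K0: "K 0 = E0"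
      and KSuc: "K (Suc m) n = K m n \<union> (\<Union>a\<in>M. {p \<in> E a n. proj (N a) p \<in> K m n})" for m n
      by (simp_all add: K_def)
    \<comment> \<open>All pieces use the same \<open>n\<close>, so that
      \<open>compactin_proj_extension\<close> handles the uncountable union over \<open>a\<close> in
      one step.\<close>
    have K_compact: "compactin X (K m n)" for m n
    proof (induction m)
      case (Suc m)
      have "compactin X (K m n \<union> (\<Union>a\<in>Field r. {p \<in> E a n. proj (N a) p \<in> K m n}))"
      proof (rule compactin_proj_extension[where N' = N'])
        show "E a n \<subseteq> N' a" if "a \<in> Field r" for a
          using E(3)[of a] that r(3) by blast
      qed (use r N NN' N'N E(1) Suc in auto)
      then show ?case
        by (simp add: KSuc r(3))
    qed (simp add: K0 E0)
    have K_mono1: "K m n \<subseteq> K m' n" if "m \<le> m'" for m m' n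
      using that by (rule lift_Suc_mono_le[rotated]) (auto simp: KSuc)
    have K_mono2: "K m n \<subseteq> K m n'" if "n \<le> n'" for m n n'
    proof (induction m)
      case 0
      show ?case
        using E0(2) that by (simp add: K0 monoD)
    next
      case (Suc m)
      have "E a n \<subseteq> E a n'" if "a \<in> M" for a
        using E(2)[OF that] \<open>n \<le> n'\<close> by (simp add: monoD)
      then show ?case
        unfolding KSuc using Suc by blast
    qed
    have K_subset: "K m n \<subseteq> M" for m n
    proof (induction m)
      case 0
      then show ?case
        unfolding K0 using E0(3) skeletal_hull_least[OF M, of "{}"] by blast
    next
      case (Suc m)
      then show ?case
        unfolding KSuc using E(3) N'(2) by blast
    qed
    have cover: "a \<in> M \<longrightarrow> N' a \<subseteq> (\<Union>m n. K m n)" for a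
      using wf
    proof (induction a rule: wf_induct_rule)
      case (less a)
      show ?case
      proof (intro impI subsetI)
        fix p assume a: "a \<in> M" and p: "p \<in> N' a"
        \<comment> \<open>\<open>N a\<close> is exhausted by the earlier sets \<open>N' b\<close>;
          the hull of the empty set keeps the chain nonempty when \<open>a\<close> has no
          predecessor.\<close>
        let ?C = "insert (skeletal_hull {}) (N' ` underS r a)"
        have "skeletal (\<Union>?C)"
        proof (rule skeletal_Union_chain)
          show "skeletal A" if "A \<in> ?C" for A
            using that skeletal_hull_empty N'(1) below by blast
          have N'_mono: "N' b \<subseteq> N' c" if "(b, c) \<in> r - Id" "c \<in> M" for b c
            using N'N[OF that(1)] NN'[OF that(2)] by blast
          have N'_comp: "N' b \<subseteq> N' c \<or> N' c \<subseteq> N' b" if "b \<in> M" "c \<in> M" for b c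
          proof -
            have "b = c \<or> (b, c) \<in> r - Id \<or> (c, b) \<in> r - Id"
              using tot that r(3) unfolding total_on_def by blast
            then show ?thesis
              using N'_mono[of b c] N'_mono[of c b] that by auto
          qed
          have "skeletal_hull {} \<subseteq> N' b" if "b \<in> M" for b
            using skeletal_hull_least[OF N'(1)[OF that]] by simp
          then show "A \<subseteq> B \<or> B \<subseteq> A" if "A \<in> ?C" "B \<in> ?C" for A B
            using that N'_comp below by blast
        qed simp
        moreover have "b \<in> N' b" for b
          using skeletal_hull_superset[of "insert b (underS r b)"] unfolding N'_def by simp
        then have "underS r a \<subseteq> \<Union>?C"
          by blast
        ultimately have "N a \<subseteq> \<Union>?C"
          unfolding N_def by (rule skeletal_hull_least)
        moreover have "N' b \<subseteq> (\<Union>m n. K m n)" if "b \<in> underS r a" for b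
          using less[of b] that below by (auto simp: underS_def)
        moreover have "skeletal_hull {} \<subseteq> (\<Union>m n. K m n)"
          using K0 E0(3) by blast
        ultimately have "N a \<subseteq> (\<Union>m n. K m n)"
          by blast
        moreover have "p \<in> topspace X"
          using p N'(2)[OF a] MT by blast
        ultimately obtain m n where mn: "proj (N a) p \<in> K m n"
          using proj_in[OF N] by blast
        obtain k where k: "p \<in> E a k"
          using p E(3)[OF a] by blast
        \<comment> \<open>The projection and the point may appear at different levels; monotonicity
          moves both to a common one.\<close>
        have "proj (N a) p \<in> K m (max n k)"
          using mn K_mono2[of n "max n k"] by auto
        moreover have "p \<in> E a (max n k)"
          using k monoD[OF E(2)[OF a], of k "max n k"] by auto
        ultimately have "p \<in> K (Suc m) (max n k)"
          using a by (auto simp: KSuc)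
        then show "p \<in> (\<Union>m n. K m n)"
          by blast
      qed
    qed
    \<comment> \<open>The diagonal turns the doubly indexed family into the increasing sequence that
      the induction asks for.\<close>
    have K_diag: "K m n \<subseteq> K (max m n) (max m n)" for m n
      using K_mono1[of m "max m n" n] K_mono2[of n "max m n" "max m n"] by auto
    have "(\<Union>n. K n n) = M"
    proof
      show "(\<Union>n. K n n) \<subseteq> M"
        using K_subset by blast
      show "M \<subseteq> (\<Union>n. K n n)"
      proof
        fix a assume "a \<in> M"
        then have "a \<in> (\<Union>m n. K m n)"
          using cover[of a] skeletal_hull_superset[of "insert a (underS r a)"] unfolding N'_def by blast
        then obtain m n where "a \<in> K m n"
          by blast
        then show "a \<in> (\<Union>n. K n n)"
          using K_diag by blast
      qed
    qed
    moreover have "mono (\<lambda>n. K n n)"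
      using K_mono1 K_mono2 by (intro monoI) (rule order_trans)
    ultimately show ?thesis
      using K_compact by (intro exI[of _ "\<lambda>n. K n n"]) blast
  qed
qed

end

section \<open>Construction of the operation from the topological hypotheses\<close>

theorem theorem1p3:
  fixes X :: "'a topology"
  assumes "regular_space X" and "t1_space X"
    and "Lindelof_space X"
    and "scattered_space X"
    and "W_space X"
  shows "sigma_compact_space X"
proof -
  have Hausdorff: "Hausdorff_space X"
    using assms regular_t1_imp_Hausdorff_space by blast
  obtain R :: "'a rel" where "wf R" and
    R: "\<And>y. y \<in> topspace X \<Longrightarrow> \<exists>U. openin X U \<and> y \<in> U \<and> (\<forall>z\<in>U. z \<noteq> y \<longrightarrow> (z, y) \<in> R)"
    by (rule scattered_space_wf[OF assms(4)]) (rule that)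
  \<comment> \<open>Regularity provides closed neighbourhoods \<open>C y\<close>, so that
    \<open>C y\<close> minus an open strategy value is closed and the Lindelof property applies to
    it.\<close>
  have "\<exists>V C. openin X V \<and> closedin X C \<and> y \<in> V \<and> V \<subseteq> C \<and> (\<forall>z\<in>C. z \<noteq> y \<longrightarrow> (z, y) \<in> R)"
    if y: "y \<in> topspace X" for y
  proof -
    obtain U where U: "openin X U" "y \<in> U" "\<forall>z\<in>U. z \<noteq> y \<longrightarrow> (z, y) \<in> R"
      using R[OF y] by blast
    have "neighbourhood_base_of (closedin X) X"
      using assms(1) by (simp add: neighbourhood_base_of_closedin)
    then obtain V C where "openin X V" "closedin X C" "y \<in> V" "V \<subseteq> C" "C \<subseteq> U"
      using U(1,2) unfolding neighbourhood_base_of by meson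
    then show ?thesis
      using U(3) by blast
  qed
  then obtain V C where V: "\<And>y. y \<in> topspace X \<Longrightarrow> openin X (V y) \<and> y \<in> V y"
    and C: "\<And>y. y \<in> topspace X \<Longrightarrow> closedin X (C y) \<and> V y \<subseteq> C y \<and> (\<forall>z\<in>C y. z \<noteq> y \<longrightarrow> (z, y) \<in> R)"
    by metis
  obtain \<sigma> where \<sigma>: "\<And>y. y \<in> topspace X \<Longrightarrow> W_winning_strategy X y (\<sigma> y)"
    and sep: "\<And>y z. y \<in> topspace X \<Longrightarrow> z \<in> topspace X \<Longrightarrow> y \<noteq> z \<Longrightarrow> \<sigma> y [z] \<inter> \<sigma> z [y] = {}"
    by (rule W_space_separating_strategies[OF Hausdorff assms(5)]) (rule that)
  have \<sigma>_open: "openin X (\<sigma> y l)" "y \<in> \<sigma> y l" if "y \<in> topspace X" "set l \<subseteq> topspace X" for y l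
    using \<sigma> that unfolding W_winning_strategy_def W_strategy_def by auto
  have cover_ex: "\<exists>D. countable D \<and> D \<subseteq> F \<and> F \<subseteq> (\<Union>c\<in>D. V c)" if F: "closedin X F" for F
  proof -
    have "openin X (V c) \<and> c \<in> V c" if "c \<in> F" for c
      using V closedin_subset[OF F] that by blast
    from Lindelof_space_closedin_countable_cover[OF assms(3) F this]
    obtain D where "countable D" "D \<subseteq> F" "F \<subseteq> (\<Union>c\<in>D. V c)" .
    then show ?thesis
      by blast
  qed
  \<comment> \<open>The default value \<open>{}\<close> for sets that are not closed makes
    \<open>cov\<close> total, with countability and the inclusion in the space
    unconditional.\<close>
  have "\<exists>D. countable D \<and> D \<subseteq> topspace X \<and> (closedin X F \<longrightarrow> D \<subseteq> F \<and> F \<subseteq> (\<Union>c\<in>D. V c))" for F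
  proof (cases "closedin X F")
    case True
    then show ?thesis
      using cover_ex closedin_subset by (metis order_trans)
  next
    case False
    then show ?thesis
      by (intro exI[of _ "{}"]) simp
  qed
  then obtain cov where cov_countable: "\<And>F. countable (cov F)"
    and cov_topspace: "\<And>F. cov F \<subseteq> topspace X"
    and cov: "\<And>F. closedin X F \<Longrightarrow> cov F \<subseteq> F \<and> F \<subseteq> (\<Union>c\<in>cov F. V c)"
    by metis
  have "\<exists>t. set t \<subseteq> topspace X \<and> (z \<in> topspace X \<longrightarrow> q \<in> topspace X \<longrightarrow> set l \<subseteq> topspace X \<longrightarrow>
      z \<in> \<sigma> q l \<longrightarrow> \<sigma> z t \<subseteq> \<sigma> q l)" for z q l
  proof (cases "z \<in> topspace X \<and> z \<in> \<sigma> q l \<and> q \<in> topspace X \<and> set l \<subseteq> topspace X")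
    case True
    then have z: "z \<in> topspace X" "z \<in> \<sigma> q l" and q: "q \<in> topspace X" "set l \<subseteq> topspace X"
      by auto
    obtain t where t: "set t \<subseteq> topspace X" "\<sigma> z t \<inter> topspace X \<subseteq> \<sigma> q l"
      using W_strategy_restricted_cofinal[OF \<sigma>[OF z(1)] order_refl \<sigma>_open(1)[OF q] z(2)] .
    then show ?thesis
      using openin_subset[OF \<sigma>_open(1)[OF z(1) t(1)]] by blast
  next
    case False
    then show ?thesis
      by (intro exI[of _ "[]"]) auto
  qed
  then obtain nest where nest_topspace: "\<And>z q l. set (nest z q l) \<subseteq> topspace X"
    and nest: "\<And>z q l. z \<in> topspace X \<Longrightarrow> q \<in> topspace X \<Longrightarrow> set l \<subseteq> topspace X \<Longrightarrow>
      z \<in> \<sigma> q l \<Longrightarrow> \<sigma> z (nest z q l) \<subseteq> \<sigma> q l"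
    by metis
  \<comment> \<open>One operation serves three purposes: the empty list covers the whole space,
    \<open>y # s\<close> covers the part of \<open>C y\<close> missed after the moves
    \<open>s\<close>, and a list \<open>y # q # t\<close> also records the nested moves.\<close>
  define \<Phi> where "\<Phi> l = (case l of [] \<Rightarrow> cov (topspace X) | y # s \<Rightarrow>
      cov (C y - \<sigma> y s) \<union> (case s of [] \<Rightarrow> {} | q # t \<Rightarrow> set (nest y q t)))" for l
  have closed: "closedin X (C y - \<sigma> y s)" if "y \<in> topspace X" "set s \<subseteq> topspace X" for y s
    using C \<sigma>_open that by (blast intro: closedin_diff)
  have "W_skeleton X \<sigma> \<Phi>"
  proof
    show "countable (\<Phi> l)" for l
      using cov_countable by (auto simp: \<Phi>_def countable_finite split: list.split)
    show "\<Phi> l \<subseteq> topspace X" if "set l \<subseteq> topspace X" for l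
      using cov_topspace nest_topspace by (simp add: \<Phi>_def split: list.split)
    show "\<exists>t. set t \<subseteq> \<Phi> (z # q # l) \<and> \<sigma> z t \<subseteq> \<sigma> q l"
      if "z \<in> topspace X" "q \<in> topspace X" "set l \<subseteq> topspace X" "z \<in> \<sigma> q l" for z q l
      using nest[OF that] that by (intro exI[of _ "nest z q l"]) (simp add: \<Phi>_def)
    show "\<exists>y\<in>M. \<forall>l. set l \<subseteq> M \<longrightarrow> p \<in> \<sigma> y l"
      if M: "M \<subseteq> topspace X" "\<And>l. set l \<subseteq> M \<Longrightarrow> \<Phi> l \<subseteq> M" and p: "p \<in> topspace X" for M p
    proof -
      obtain c where c: "c \<in> cov (topspace X)" "p \<in> V c"
        using cov[OF closedin_topspace] p by blast
      have "c \<in> M"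
        using M(2)[of "[]"] c by (simp add: \<Phi>_def subset_iff)
      \<comment> \<open>Take \<open>y\<close> of least rank in \<open>M\<close> with
        \<open>p\<close> in \<open>V y\<close>. If \<open>p\<close> escaped
        \<open>\<sigma> y l\<close>, the recorded cover of \<open>C y - \<sigma> y l\<close> would
        give another such point of \<open>M\<close> in \<open>C y\<close>, of smaller rank than
        \<open>y\<close>.\<close>
      then have "c \<in> {y \<in> M. p \<in> V y}"
        using c by blast
      from wfE_min[OF \<open>wf R\<close> this]
      obtain y where "y \<in> {y \<in> M. p \<in> V y}" "\<And>z. (z, y) \<in> R \<Longrightarrow> z \<notin> {y \<in> M. p \<in> V y}"
        by metis
      then have y: "y \<in> M" "p \<in> V y" "\<And>z. (z, y) \<in> R \<Longrightarrow> z \<in> M \<Longrightarrow> p \<notin> V z"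
        by simp_all
      have yT: "y \<in> topspace X"
        using y(1) M(1) by blast
      have "p \<in> \<sigma> y l" if l: "set l \<subseteq> M" for l
      proof (rule ccontr)
        assume "p \<notin> \<sigma> y l"
        then have "p \<in> C y - \<sigma> y l"
          using y(2) C[OF yT] by blast
        moreover have lT: "set l \<subseteq> topspace X"
          using l M(1) by blast
        ultimately obtain z where z: "z \<in> cov (C y - \<sigma> y l)" "p \<in> V z"
          using cov[OF closed[OF yT lT]] by blast
        have "z \<in> C y - \<sigma> y l"
          using z(1) cov[OF closed[OF yT lT]] by blast
        moreover have "z \<noteq> y"
          using \<open>z \<in> C y - \<sigma> y l\<close> \<sigma>_open(2)[OF yT lT] by blast
        ultimately have "(z, y) \<in> R"
          using C[OF yT] by simp
        moreover have "z \<in> M"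
          using M(2)[of "y # l"] y(1) l z(1) yT lT by (auto simp: \<Phi>_def)
        ultimately show False
          using y(3) z(2) by blast
      qed
      then show ?thesis
        using y(1) by blast
    qed
  qed (use Hausdorff \<sigma> sep in auto)
  then interpret W_skeleton X \<sigma> \<Phi> .
  have "skeletal (topspace X)"
    using op_subset by (simp add: skeletal_def)
  from skeletal_sigma_compact[OF this] obtain E :: "nat \<Rightarrow> 'a set" where
    "\<forall>n. compactin X (E n)" "\<Union>(range E) = topspace X"
    by blast
  then show ?thesis
    unfolding sigma_compact_space_def by (intro exI[of _ "range E"]) auto
qed

end
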